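(* Let $p$ be a prime with $p\geq 3$, and let $G$ be the dihedral group of order $2p$. Then $s(G)=4p+7$, where $s(G)$ is the number of equivalence classes of the relation $\sim$ on $F_1(G)$.
   Context: A fuzzy subset of a group $G$ is a map $\mu:G\to[0,1]$. It is a fuzzy subgroup of $G$ if $\mu(xy)\geq\min\{\mu(x),\mu(y)\}$ and $\mu(x^{-1})\geq\mu(x)$ for all $x,y\in G$. $F_1(G)$ denotes the set of all fuzzy subgroups $\mu$ of $G$ with $\mu(e)=1$, where $e$ is the identity of $G$. For fuzzy subgroups $\mu,\nu$ of $G$, write $\mu\sim\nu$ if (1) for all $x,y\in G$, $\mu(x)>\mu(y)\Leftrightarrow\nu(x)>\nu(y)$, and (2) for all $x\in G$, $\mu(x)=0\Leftrightarrow\nu(x)=0$. This is an equivalence relation; $s(G)$ denotes the number of equivalence classes of $\sim$ on $F_1(G)$ (the "number of distinct fuzzy subgroups of $G$"). The dihedral group of order $2n$ is $D_{2n}=\langle\alpha,\beta\mid\alpha^n=\beta^2=1,\ \beta\alpha\beta=\alpha^{-1}\rangle$. *)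

theory Defs
  imports Complex_Main "HOL-Algebra.Group" "HOL-Library.FuncSet" "HOL-Computational_Algebra.Primes"
begin

section \<open>Groups given by generators and relations\<close>

text \<open>
  A word is a list of signed letters: \<open>(x, True)\<close> stands for the generator \<open>x\<close> and
  \<open>(x, False)\<close> for its formal inverse. A pair \<open>(u, v)\<close> in \<open>R\<close> is the relation \<open>u = v\<close>.
  The relation \<open>pres_eq R\<close> is the least congruence on words containing \<open>R\<close> and free cancellation,
  so its quotient is the group \<open>\<langle>'a | R\<rangle>\<close>, with every element of \<open>'a\<close> a generator.
\<close>

type_synonym 'a word = "('a \<times> bool) list"

inductive pres_eq :: "('a word \<times> 'a word) set \<Rightarrow> 'a word \<Rightarrow> 'a word \<Rightarrow> bool"
  for R :: "('a word \<times> 'a word) set" where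
  rel: "(u, v) \<in> R \<Longrightarrow> pres_eq R u v"
| cancel: "pres_eq R [(x, s), (x, \<not> s)] []"
| refl: "pres_eq R u u"
| sym: "pres_eq R u v \<Longrightarrow> pres_eq R v u"
| trans: "pres_eq R u v \<Longrightarrow> pres_eq R v w \<Longrightarrow> pres_eq R u w"
| cong: "pres_eq R u u' \<Longrightarrow> pres_eq R v v' \<Longrightarrow> pres_eq R (u @ v) (u' @ v')"

definition pres_class :: "('a word \<times> 'a word) set \<Rightarrow> 'a word \<Rightarrow> 'a word set" where
  "pres_class R u = {v. pres_eq R u v}"

definition presented_group :: "('a word \<times> 'a word) set \<Rightarrow> 'a word set monoid" where
  "presented_group R =
     \<lparr>carrier = range (pres_class R),
      monoid.mult = (\<lambda>A B. {w. \<exists>u\<in>A. \<exists>v\<in>B. pres_eq R (u @ v) w}),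
      one = pres_class R []\<rparr>"

lemma pres_class_eq_iff: "pres_class R u = pres_class R v \<longleftrightarrow> pres_eq R u v"
  unfolding pres_class_def by (blast intro: pres_eq.refl pres_eq.sym pres_eq.trans)

lemma mult_pres_class:
  "pres_class R u \<otimes>\<^bsub>presented_group R\<^esub> pres_class R v = pres_class R (u @ v)"
  unfolding presented_group_def pres_class_def
  by (auto intro: pres_eq.refl pres_eq.trans pres_eq.cong)

lemma pres_eq_inverse: "\<exists>v. pres_eq R (v @ u) []"
proof (induction u)
  case Nil
  show ?case by (metis append_Nil pres_eq.refl)
next
  case (Cons a u)
  then obtain v where v: "pres_eq R (v @ u) []" by blast
  obtain x s where a: "a = (x, s)" by (cases a)
  have "pres_eq R [(x, \<not> s), (x, s)] []"
    using pres_eq.cancel[of R x "\<not> s"] by simp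
  then have "pres_eq R (v @ ([(x, \<not> s), (x, s)] @ u)) (v @ ([] @ u))"
    by (intro pres_eq.cong pres_eq.refl)
  then have "pres_eq R ((v @ [(x, \<not> s)]) @ a # u) []"
    using v pres_eq.trans a by fastforce
  then show ?case by blast
qed

lemma group_presented_group: "group (presented_group R)"
proof (rule groupI)
  fix A B C
  assume "A \<in> carrier (presented_group R)" "B \<in> carrier (presented_group R)"
    "C \<in> carrier (presented_group R)"
  then obtain u v w where "A = pres_class R u" "B = pres_class R v" "C = pres_class R w"
    by (auto simp: presented_group_def)
  then show "A \<otimes>\<^bsub>presented_group R\<^esub> B \<otimes>\<^bsub>presented_group R\<^esub> C =
      A \<otimes>\<^bsub>presented_group R\<^esub> (B \<otimes>\<^bsub>presented_group R\<^esub> C)"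
    by (simp add: mult_pres_class)
next
  fix A B
  assume "A \<in> carrier (presented_group R)" "B \<in> carrier (presented_group R)"
  then obtain u v where "A = pres_class R u" "B = pres_class R v"
    by (auto simp: presented_group_def)
  then show "A \<otimes>\<^bsub>presented_group R\<^esub> B \<in> carrier (presented_group R)"
    by (simp add: mult_pres_class) (simp add: presented_group_def)
next
  show "\<one>\<^bsub>presented_group R\<^esub> \<in> carrier (presented_group R)"
    by (simp add: presented_group_def)
next
  have one: "\<one>\<^bsub>presented_group R\<^esub> = pres_class R []"
    by (simp add: presented_group_def)
  fix A
  assume "A \<in> carrier (presented_group R)"
  then obtain u where u: "A = pres_class R u"
    by (auto simp: presented_group_def)
  show "\<one>\<^bsub>presented_group R\<^esub> \<otimes>\<^bsub>presented_group R\<^esub> A = A"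
    by (simp add: one u mult_pres_class)
  obtain v where "pres_eq R (v @ u) []"
    using pres_eq_inverse by blast
  then have "pres_class R v \<otimes>\<^bsub>presented_group R\<^esub> A = \<one>\<^bsub>presented_group R\<^esub>"
    by (simp add: one u mult_pres_class pres_class_eq_iff)
  moreover have "pres_class R v \<in> carrier (presented_group R)"
    by (simp add: presented_group_def)
  ultimately show "\<exists>B\<in>carrier (presented_group R).
      B \<otimes>\<^bsub>presented_group R\<^esub> A = \<one>\<^bsub>presented_group R\<^esub>"
    by blast
qed


section \<open>Dihedral groups\<close>

datatype dihedral_gen = Alpha | Beta

definition dihedral_relations :: "nat \<Rightarrow> (dihedral_gen word \<times> dihedral_gen word) set" where
  "dihedral_relations n =
     {(replicate n (Alpha, True), []),
      ([(Beta, True), (Beta, True)], []),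
      ([(Beta, True), (Alpha, True), (Beta, True)], [(Alpha, False)])}"

text \<open>The parameter is \<open>n\<close>, not the order \<open>2 * n\<close>.\<close>

definition dihedral_group :: "nat \<Rightarrow> dihedral_gen word set monoid" where
  "dihedral_group n = presented_group (dihedral_relations n)"


section \<open>Fuzzy subgroups\<close>

text \<open>
  Fuzzy subsets are extensional functions on the carrier, so that they correspond exactly to
  maps \<open>carrier G \<rightarrow> [0,1]\<close>.
\<close>

definition fuzzy_subset :: "('a, 'b) monoid_scheme \<Rightarrow> ('a \<Rightarrow> real) \<Rightarrow> bool" where
  "fuzzy_subset G \<mu> \<longleftrightarrow> \<mu> \<in> carrier G \<rightarrow>\<^sub>E {0..1}"

definition fuzzy_subgroup :: "('a, 'b) monoid_scheme \<Rightarrow> ('a \<Rightarrow> real) \<Rightarrow> bool" where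
  "fuzzy_subgroup G \<mu> \<longleftrightarrow> fuzzy_subset G \<mu> \<and>
     (\<forall>x\<in>carrier G. \<forall>y\<in>carrier G. \<mu> (x \<otimes>\<^bsub>G\<^esub> y) \<ge> min (\<mu> x) (\<mu> y)) \<and>
     (\<forall>x\<in>carrier G. \<mu> (inv\<^bsub>G\<^esub> x) \<ge> \<mu> x)"

definition F1 :: "('a, 'b) monoid_scheme \<Rightarrow> ('a \<Rightarrow> real) set" where
  "F1 G = {\<mu>. fuzzy_subgroup G \<mu> \<and> \<mu> \<one>\<^bsub>G\<^esub> = 1}"

definition fuzzy_equiv :: "('a, 'b) monoid_scheme \<Rightarrow> ('a \<Rightarrow> real) \<Rightarrow> ('a \<Rightarrow> real) \<Rightarrow> bool" where
  "fuzzy_equiv G \<mu> \<nu> \<longleftrightarrow>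
     (\<forall>x\<in>carrier G. \<forall>y\<in>carrier G. \<mu> x > \<mu> y \<longleftrightarrow> \<nu> x > \<nu> y) \<and>
     (\<forall>x\<in>carrier G. \<mu> x = 0 \<longleftrightarrow> \<nu> x = 0)"

definition fuzzy_rel :: "('a, 'b) monoid_scheme \<Rightarrow> (('a \<Rightarrow> real) \<times> ('a \<Rightarrow> real)) set" where
  "fuzzy_rel G = {(\<mu>, \<nu>). \<mu> \<in> F1 G \<and> \<nu> \<in> F1 G \<and> fuzzy_equiv G \<mu> \<nu>}"

lemma equiv_fuzzy_rel: "equiv (F1 G) (fuzzy_rel G)"
  by (rule equivI)
    (auto simp: fuzzy_rel_def fuzzy_equiv_def refl_on_def intro!: symI transI)

text \<open>
  Since \<open>card\<close> of an infinite set is 0, a positive value of \<open>num_fuzzy_subgroups\<close> also asserts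
  that the number of classes is finite.
\<close>

definition num_fuzzy_subgroups :: "('a, 'b) monoid_scheme \<Rightarrow> nat" where
  "num_fuzzy_subgroups G = card (F1 G // fuzzy_rel G)"

end

theory Submission
  imports Defs "HOL-Algebra.Multiplicative_Group"
begin

text \<open>
  The sets \<open>{x. t < \<mu> x}\<close> with \<open>t < 1\<close> of a fuzzy subgroup \<open>\<mu>\<close> with \<open>\<mu> 1 = 1\<close> form a chain of
  subgroups. Suppose that the proper nontrivial subgroups of a nontrivial group \<open>G\<close> form an
  antichain. Then at most one of them occurs among these sets, so \<open>\<mu>\<close> takes at most two values
  off the identity: either \<open>\<mu>\<close> is constant there, or there are a proper nontrivial
  subgroup \<open>H\<close> and reals \<open>1 \<ge> u > v \<ge> 0\<close> such that \<open>\<mu>\<close> is \<open>u\<close> on \<open>H - {1}\<close> and \<open>v\<close> outside \<open>H\<close>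
  (\<open>F1_eq_step_fuzzy\<close>). The class of \<open>\<mu>\<close> remembers, in the second case, \<open>H\<close> and whether \<open>u = 1\<close>
  and whether \<open>v = 0\<close>, which makes four classes for every \<open>H\<close>; in the first case it remembers
  whether the constant is \<open>0\<close>, \<open>1\<close> or strictly between, which makes three classes. With \<open>N\<close> proper
  nontrivial subgroups there are \<open>4 * N + 3\<close> classes (\<open>num_fuzzy_subgroups_antichain\<close>).

  In the dihedral group of order \<open>2 * p\<close> a proper nontrivial subgroup has prime order by Lagrange's
  theorem, which gives the antichain property. These subgroups are the rotation group of order \<open>p\<close>
  and the \<open>p\<close> groups generated by a reflection, so \<open>N = p + 1\<close> and \<open>4 * N + 3 = 4 * p + 7\<close>
  (\<open>proper_subgroups_dihedral_type\<close>).

  That the presented group really has order \<open>2 * p\<close> needs a model in which the generators do not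
  collapse: \<open>\<alpha>\<close> acts on the integers modulo \<open>p\<close> by \<open>x \<mapsto> x + 1\<close> and \<open>\<beta>\<close> by \<open>x \<mapsto> - x\<close>
  (\<open>pres_eq_dihedral_act\<close>).
\<close>

section \<open>Fuzzy subgroups of groups whose proper nontrivial subgroups form an antichain\<close>

text \<open>
  The fuzzy subset with value \<open>1\<close> at the identity, \<open>u\<close> on the rest of \<open>H\<close> and \<open>v\<close> outside \<open>H\<close>.
\<close>

definition step_fuzzy :: "('a, 'b) monoid_scheme \<Rightarrow> 'a set \<Rightarrow> real \<Rightarrow> real \<Rightarrow> 'a \<Rightarrow> real" where
  "step_fuzzy G H u v =
     (\<lambda>x\<in>carrier G. if x = \<one>\<^bsub>G\<^esub> then 1 else if x \<in> H then u else v)"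

text \<open>The subgroups other than the trivial one and the whole group.\<close>

definition proper_subgroups :: "('a, 'b) monoid_scheme \<Rightarrow> 'a set set" where
  "proper_subgroups G = {H. subgroup H G \<and> H \<noteq> {\<one>\<^bsub>G\<^esub>} \<and> H \<noteq> carrier G}"

text \<open>
  Parameters of one step function in each equivalence class, when the group is nontrivial and its
  proper nontrivial subgroups form an antichain. The values \<open>1/2\<close> and \<open>1/4\<close> are arbitrary choices
  strictly between \<open>0\<close> and the next larger value. A step function that is constant off the identity
  does not depend on \<open>H\<close>; it is listed only once, with \<open>H = carrier G\<close>.
\<close>

definition step_reps :: "('a, 'b) monoid_scheme \<Rightarrow> ('a set \<times> real \<times> real) set" where
  "step_reps G = proper_subgroups G \<times> {(1, 1/2), (1, 0), (1/2, 1/4), (1/2, 0)}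
     \<union> {carrier G} \<times> {(1, 1), (1/2, 1/2), (0, 0)}"

text \<open>
  The points at which \<open>\<mu>\<close> is not minimal. Only the order of the values enters, so this set depends
  only on the class of \<open>\<mu>\<close>; it recovers \<open>H\<close> from a step function with two values off the identity.
\<close>

definition above_some :: "('a, 'b) monoid_scheme \<Rightarrow> ('a \<Rightarrow> real) \<Rightarrow> 'a set" where
  "above_some G \<mu> = {x \<in> carrier G. \<exists>y\<in>carrier G. \<mu> y < \<mu> x}"

lemma above_some_cong: "fuzzy_equiv G \<mu> \<nu> \<Longrightarrow> above_some G \<mu> = above_some G \<nu>"
  unfolding above_some_def fuzzy_equiv_def by blast

lemma card_step_reps:
  assumes "finite (proper_subgroups G)"
  shows "card (step_reps G) = 4 * card (proper_subgroups G) + 3"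
proof -
  have "proper_subgroups G \<inter> {carrier G} = {}"
    by (auto simp: proper_subgroups_def)
  then show ?thesis
    unfolding step_reps_def using assms
    by (subst card_Un_disjoint) (auto simp: card_cartesian_product)
qed

context group
begin

lemma proper_subgroupE:
  assumes "H \<in> proper_subgroups G"
  obtains h g where "subgroup H G" "H \<subseteq> carrier G" "h \<in> H" "h \<in> carrier G" "h \<noteq> \<one>"
    "g \<in> carrier G" "g \<notin> H" "g \<noteq> \<one>" "\<one> \<in> H"
proof -
  from assms have H: "subgroup H G" "H \<noteq> {\<one>}" "H \<noteq> carrier G"
    by (auto simp: proper_subgroups_def)
  have s: "H \<subseteq> carrier G" and o: "\<one> \<in> H"
    using H subgroup.subset subgroup.one_closed by blast+
  from H s o obtain h where h: "h \<in> H" "h \<noteq> \<one>" by blast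
  from H s obtain g where g: "g \<in> carrier G" "g \<notin> H" by blast
  show ?thesis using that[of h g] H h g s o by blast
qed

lemma step_fuzzy_in_F1:
  assumes "subgroup H G" "0 \<le> v" "v \<le> u" "u \<le> 1"
  shows "step_fuzzy G H u v \<in> F1 G"
proof -
  note H = subgroup.subset[OF assms(1)] subgroup.one_closed[OF assms(1)]
    subgroup.m_closed[OF assms(1)] subgroup.m_inv_closed[OF assms(1)]
  show ?thesis
    unfolding F1_def fuzzy_subgroup_def fuzzy_subset_def step_fuzzy_def
    using assms H by (auto simp: min_def)
qed

lemma step_fuzzy_equiv:
  assumes "v \<le> u" "u \<le> 1" "v' \<le> u'" "u' \<le> 1"
    and "u < 1 \<longleftrightarrow> u' < 1" "v < u \<longleftrightarrow> v' < u'" "u = 0 \<longleftrightarrow> u' = 0" "v = 0 \<longleftrightarrow> v' = 0"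
  shows "fuzzy_equiv G (step_fuzzy G H u v) (step_fuzzy G H u' v')"
  unfolding fuzzy_equiv_def step_fuzzy_def using assms by auto

lemma F1_bounds: "\<mu> \<in> F1 G \<Longrightarrow> x \<in> carrier G \<Longrightarrow> 0 \<le> \<mu> x \<and> \<mu> x \<le> 1"
  by (auto simp: F1_def fuzzy_subgroup_def fuzzy_subset_def dest!: PiE_mem)

text \<open>The bound \<open>t < 1\<close> ensures that the identity lies in the level set.\<close>

lemma level_subgroup:
  assumes "\<mu> \<in> F1 G" "t < 1"
  shows "subgroup {x \<in> carrier G. t < \<mu> x} G"
proof (rule subgroupI)
  show "{x \<in> carrier G. t < \<mu> x} \<noteq> {}" using assms by (auto simp: F1_def)
next
  fix x assume "x \<in> {x \<in> carrier G. t < \<mu> x}"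
  moreover from this have "\<mu> x \<le> \<mu> (inv x)"
    using assms by (auto simp: F1_def fuzzy_subgroup_def)
  ultimately show "inv x \<in> {x \<in> carrier G. t < \<mu> x}" by auto
next
  fix x y assume "x \<in> {x \<in> carrier G. t < \<mu> x}" "y \<in> {x \<in> carrier G. t < \<mu> x}"
  moreover from this have "min (\<mu> x) (\<mu> y) \<le> \<mu> (x \<otimes> y)"
    using assms by (auto simp: F1_def fuzzy_subgroup_def)
  ultimately show "x \<otimes> y \<in> {x \<in> carrier G. t < \<mu> x}" by auto
qed auto

lemma level_proper:
  assumes "\<mu> \<in> F1 G" "x \<in> carrier G" "y \<in> carrier G" "y \<noteq> \<one>" "\<mu> x < \<mu> y"
  shows "{z \<in> carrier G. \<mu> x < \<mu> z} \<in> proper_subgroups G"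
proof -
  have "\<mu> x < 1" using assms F1_bounds[of \<mu> y] by linarith
  then show ?thesis
    using level_subgroup[OF assms(1)] assms unfolding proper_subgroups_def by blast
qed

text \<open>
  Three values, the largest of them attained off the identity, would give two nested proper
  nontrivial level subgroups.
\<close>

lemma no_three_levels:
  assumes anti: "\<forall>H\<in>proper_subgroups G. \<forall>K\<in>proper_subgroups G. H \<subseteq> K \<longrightarrow> H = K"
    and \<mu>: "\<mu> \<in> F1 G" and "x \<in> carrier G" "y \<in> carrier G" "z \<in> carrier G" "z \<noteq> \<one>"
    and lt: "\<mu> x < \<mu> y" "\<mu> y < \<mu> z"
  shows False
proof -
  have "{w \<in> carrier G. \<mu> y < \<mu> w} = {w \<in> carrier G. \<mu> x < \<mu> w}"
  proof (rule anti[rule_format])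
    show "{w \<in> carrier G. \<mu> y < \<mu> w} \<in> proper_subgroups G"
      using level_proper[OF \<mu>, of y z] assms by blast
    show "{w \<in> carrier G. \<mu> x < \<mu> w} \<in> proper_subgroups G"
      using level_proper[OF \<mu>, of x z] assms by auto
  qed (use lt in auto)
  then show False using assms by blast
qed

lemma F1_eq_step_fuzzy:
  assumes anti: "\<forall>H\<in>proper_subgroups G. \<forall>K\<in>proper_subgroups G. H \<subseteq> K \<longrightarrow> H = K"
    and nontriv: "carrier G \<noteq> {\<one>}" and \<mu>: "\<mu> \<in> F1 G"
  obtains (flat) v where "0 \<le> v" "v \<le> 1" "\<mu> = step_fuzzy G (carrier G) v v"
  | (proper) H u v where "H \<in> proper_subgroups G" "0 \<le> v" "v < u" "u \<le> 1" "\<mu> = step_fuzzy G H u v"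
proof -
  have one: "\<mu> \<one> = 1" using \<mu> by (simp add: F1_def)
  have "\<mu> \<in> carrier G \<rightarrow>\<^sub>E {0..1}"
    using \<mu> by (simp add: F1_def fuzzy_subgroup_def fuzzy_subset_def)
  then have ext: "\<mu> x = undefined" if "x \<notin> carrier G" for x
    using that by (rule PiE_arb)
  show thesis
  proof (cases "\<exists>g\<in>carrier G. \<exists>h\<in>carrier G. h \<noteq> \<one> \<and> \<mu> g < \<mu> h")
    case True
    then obtain g h where gh: "g \<in> carrier G" "h \<in> carrier G" "h \<noteq> \<one>" "\<mu> g < \<mu> h" by blast
    define H where "H = {z \<in> carrier G. \<mu> g < \<mu> z}"
    have H: "H \<in> proper_subgroups G" unfolding H_def using level_proper[OF \<mu>] gh by blast
    have inside: "\<mu> x = \<mu> h" if "x \<in> H" "x \<noteq> \<one>" for x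
    proof (rule ccontr)
      assume ne: "\<mu> x \<noteq> \<mu> h"
      have x: "x \<in> carrier G" "\<mu> g < \<mu> x" using that(1) by (auto simp: H_def)
      show False
        using no_three_levels[OF anti \<mu> gh(1) x(1) gh(2,3) x(2)]
          no_three_levels[OF anti \<mu> gh(1,2) x(1) that(2) gh(4)] ne by linarith
    qed
    have outside: "\<mu> x = \<mu> g" if "x \<in> carrier G" "x \<notin> H" for x
    proof (rule ccontr)
      assume "\<mu> x \<noteq> \<mu> g"
      moreover have "\<mu> x \<le> \<mu> g" using that unfolding H_def by simp
      ultimately show False
        using no_three_levels[OF anti \<mu> that(1) gh(1,2,3)] gh(4) by linarith
    qed
    have "\<mu> = step_fuzzy G H (\<mu> h) (\<mu> g)"
    proof
      fix x show "\<mu> x = step_fuzzy G H (\<mu> h) (\<mu> g) x"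
        unfolding step_fuzzy_def restrict_def
        using inside[of x] outside[of x] one ext[of x] by presburger
    qed
    then show thesis
      using proper[OF H, of "\<mu> g" "\<mu> h"] gh F1_bounds[OF \<mu> gh(1)] F1_bounds[OF \<mu> gh(2)] by simp
  next
    case False
    obtain g where g: "g \<in> carrier G" "g \<noteq> \<one>" using nontriv by blast
    have const: "\<mu> x = \<mu> g" if "x \<in> carrier G" "x \<noteq> \<one>" for x
      using False g that by (meson linorder_less_linear)
    have "\<mu> = step_fuzzy G (carrier G) (\<mu> g) (\<mu> g)"
    proof
      fix x show "\<mu> x = step_fuzzy G (carrier G) (\<mu> g) (\<mu> g) x"
        unfolding step_fuzzy_def restrict_def
        using const[of x] one ext[of x] by presburger
    qed
    then show thesis using flat[of "\<mu> g"] F1_bounds[OF \<mu> g(1)] by simp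
  qed
qed

lemma step_reps_bounds:
  assumes "(H, u, v) \<in> step_reps G"
  shows "subgroup H G" "0 \<le> v" "v \<le> u" "u \<le> 1"
  using assms subgroup_self by (auto simp: step_reps_def proper_subgroups_def)

lemma above_some_step_fuzzy:
  assumes "H \<in> proper_subgroups G" "v < u" "u \<le> 1"
  shows "above_some G (step_fuzzy G H u v) = H"
  using assms by (elim proper_subgroupE) (force simp: above_some_def step_fuzzy_def)

lemma above_some_step_fuzzy_flat:
  "above_some G (step_fuzzy G (carrier G) v v) \<subseteq> {\<one>}" if "v \<le> 1"
  using that by (auto simp: above_some_def step_fuzzy_def split: if_splits)

text \<open>
  Representatives with different parameters are inequivalent: the class determines \<open>H\<close> through
  the points of non-minimal value, and the values through comparison with \<open>1 = \<mu> 1\<close> and with \<open>0\<close>.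
\<close>

lemma step_reps_inj:
  assumes nontriv: "carrier G \<noteq> {\<one>}"
    and r: "(H, u, v) \<in> step_reps G" "(H', u', v') \<in> step_reps G"
    and eq: "fuzzy_equiv G (step_fuzzy G H u v) (step_fuzzy G H' u' v')"
  shows "(H, u, v) = (H', u', v')"
proof -
  define \<mu> \<nu> where d: "\<mu> = step_fuzzy G H u v" "\<nu> = step_fuzzy G H' u' v'"
  have above: "above_some G \<mu> = above_some G \<nu>" using eq above_some_cong d by blast
  have e: "\<And>x y. x \<in> carrier G \<Longrightarrow> y \<in> carrier G \<Longrightarrow> \<mu> y < \<mu> x \<longleftrightarrow> \<nu> y < \<nu> x"
    "\<And>x. x \<in> carrier G \<Longrightarrow> \<mu> x = 0 \<longleftrightarrow> \<nu> x = 0"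
    using eq by (auto simp: d fuzzy_equiv_def)
  have proper_case: "K \<in> proper_subgroups G \<and> above_some G (step_fuzzy G K a b) = K \<and>
      (a, b) \<in> {(1, 1/2), (1, 0), (1/2, 1/4), (1/2, 0)} \<or>
      K = carrier G \<and> above_some G (step_fuzzy G K a b) \<subseteq> {\<one>} \<and>
      (a, b) \<in> {(1, 1), (1/2, 1/2), (0, 0)}" if "(K, a, b) \<in> step_reps G" for K a b
  proof (cases "K \<in> proper_subgroups G")
    case True
    then have "K \<noteq> carrier G" by (simp add: proper_subgroups_def)
    then have "(a, b) \<in> {(1, 1/2), (1, 0), (1/2, 1/4), (1/2, 0)}"
      using that by (auto simp: step_reps_def)
    moreover from this have "above_some G (step_fuzzy G K a b) = K"
      by (intro above_some_step_fuzzy[OF True]) auto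
    ultimately show ?thesis using True by blast
  next
    case False
    then have "K = carrier G" "(a, b) \<in> {(1, 1), (1/2, 1/2), (0, 0)}"
      using that by (auto simp: step_reps_def)
    moreover from this have "a = b" "b \<le> 1" by auto
    ultimately show ?thesis using above_some_step_fuzzy_flat[of b] by auto
  qed
  have not_sub: "\<not> K \<subseteq> {\<one>}" if "K \<in> proper_subgroups G" for K
    using that by (elim proper_subgroupE) auto
  from proper_case[OF r(1)] proper_case[OF r(2)] above not_sub
  consider "H \<in> proper_subgroups G" "H' = H" "(u, v) \<in> {(1, 1/2), (1, 0), (1/2, 1/4), (1/2, 0)}"
      "(u', v') \<in> {(1, 1/2), (1, 0), (1/2, 1/4), (1/2, 0)}"
    | "H = carrier G" "H' = carrier G" "(u, v) \<in> {(1, 1), (1/2, 1/2), (0, 0)}"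
      "(u', v') \<in> {(1, 1), (1/2, 1/2), (0, 0)}"
    unfolding d by metis
  then show ?thesis
  proof cases
    case 1
    from 1(1) obtain h g where "h \<in> H" "h \<in> carrier G" "h \<noteq> \<one>" "g \<in> carrier G" "g \<notin> H" "g \<noteq> \<one>"
      by (rule proper_subgroupE)
    then have "u < 1 \<longleftrightarrow> u' < 1" "v = 0 \<longleftrightarrow> v' = 0"
      using e(1)[of \<one> h] e(2)[of g] 1(2) by (auto simp: d step_fuzzy_def)
    then show ?thesis using 1 by auto
  next
    case 2
    obtain g where "g \<in> carrier G" "g \<noteq> \<one>" using nontriv by blast
    then have "v < 1 \<longleftrightarrow> v' < 1" "v = 0 \<longleftrightarrow> v' = 0"
      using e(1)[of \<one> g] e(2)[of g] 2 by (auto simp: d step_fuzzy_def)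
    then show ?thesis using 2 by auto
  qed
qed

text \<open>Every class is represented: the values of a step function can be normalised.\<close>

lemma step_reps_surj:
  assumes anti: "\<forall>H\<in>proper_subgroups G. \<forall>K\<in>proper_subgroups G. H \<subseteq> K \<longrightarrow> H = K"
    and nontriv: "carrier G \<noteq> {\<one>}" and \<mu>: "\<mu> \<in> F1 G"
  obtains H u v where "(H, u, v) \<in> step_reps G" "fuzzy_equiv G (step_fuzzy G H u v) \<mu>"
proof (rule F1_eq_step_fuzzy[OF anti nontriv \<mu>])
  fix v assume 1: "0 \<le> v" "v \<le> 1" "\<mu> = step_fuzzy G (carrier G) v v"
  define w where "w = (if v = 0 then 0 else if v = 1 then 1 else 1/2 :: real)"
  have "fuzzy_equiv G (step_fuzzy G (carrier G) w w) \<mu>"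
    unfolding 1(3) by (rule step_fuzzy_equiv) (use 1 in \<open>auto simp: w_def\<close>)
  then show thesis using that[of "carrier G" w w] by (auto simp: step_reps_def w_def)
next
  fix H u v
  assume 2: "H \<in> proper_subgroups G" "0 \<le> v" "v < u" "u \<le> 1" "\<mu> = step_fuzzy G H u v"
  define a where "a = (if u = 1 then 1 else 1/2 :: real)"
  define b where "b = (if v = 0 then 0 else a/2)"
  have "fuzzy_equiv G (step_fuzzy G H a b) \<mu>"
    unfolding 2(5) by (rule step_fuzzy_equiv) (use 2 in \<open>auto simp: a_def b_def\<close>)
  then show thesis using that[of H a b] 2 by (auto simp: step_reps_def a_def b_def)
qed

theorem num_fuzzy_subgroups_antichain:
  assumes nontriv: "carrier G \<noteq> {\<one>}" and fin: "finite (proper_subgroups G)"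
    and anti: "\<forall>H\<in>proper_subgroups G. \<forall>K\<in>proper_subgroups G. H \<subseteq> K \<longrightarrow> H = K"
  shows "num_fuzzy_subgroups G = 4 * card (proper_subgroups G) + 3"
proof -
  define q where "q = (\<lambda>(H, u, v). fuzzy_rel G `` {step_fuzzy G H u v})"
  have F1: "step_fuzzy G H u v \<in> F1 G" if "(H, u, v) \<in> step_reps G" for H u v
    using step_reps_bounds[OF that] step_fuzzy_in_F1 by blast
  have "inj_on q (step_reps G)"
  proof (rule inj_onI)
    fix r r' assume reps: "r \<in> step_reps G" "r' \<in> step_reps G" and eq: "q r = q r'"
    obtain H u v H' u' v' where r: "r = (H, u, v)" "r' = (H', u', v')" by (metis surj_pair)
    have "(step_fuzzy G H u v, step_fuzzy G H' u' v') \<in> fuzzy_rel G"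
      using eq unfolding r q_def prod.case
      by (rule eq_equiv_class[OF _ equiv_fuzzy_rel F1[OF reps(2)[unfolded r]]])
    then have "fuzzy_equiv G (step_fuzzy G H u v) (step_fuzzy G H' u' v')"
      by (simp add: fuzzy_rel_def)
    from step_reps_inj[OF nontriv reps[unfolded r] this] show "r = r'" by (simp add: r)
  qed
  moreover have "q ` step_reps G = F1 G // fuzzy_rel G"
  proof
    show "q ` step_reps G \<subseteq> F1 G // fuzzy_rel G"
      using F1 by (auto simp: q_def intro: quotientI)
    show "F1 G // fuzzy_rel G \<subseteq> q ` step_reps G"
    proof
      fix X assume "X \<in> F1 G // fuzzy_rel G"
      then obtain \<mu> where \<mu>: "\<mu> \<in> F1 G" "X = fuzzy_rel G `` {\<mu>}" by (rule quotientE)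
      from anti nontriv \<mu>(1) obtain H u v where
        r: "(H, u, v) \<in> step_reps G" "fuzzy_equiv G (step_fuzzy G H u v) \<mu>"
        by (rule step_reps_surj)
      then have "(step_fuzzy G H u v, \<mu>) \<in> fuzzy_rel G"
        using F1 \<mu> by (simp add: fuzzy_rel_def)
      then have "q (H, u, v) = X"
        unfolding q_def \<mu>(2) using equiv_class_eq[OF equiv_fuzzy_rel] by simp
      then show "X \<in> q ` step_reps G" using r by blast
    qed
  qed
  ultimately show ?thesis
    unfolding num_fuzzy_subgroups_def using card_step_reps[OF fin] card_image by metis
qed

end

section \<open>Groups of order \<open>2 * p\<close> with involutions off a subgroup of order \<open>p\<close>\<close>

context group
begin

lemma card_subgroup_dvd:
  assumes "subgroup H G" shows "card H dvd order G"
  using lagrange[OF assms] by (metis dvd_triv_right)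

lemma card_subgroup_dvd_card:
  assumes "subgroup H G" "subgroup K G" "H \<subseteq> K" shows "card H dvd card K"
proof -
  interpret K: group "G\<lparr>carrier := K\<rparr>" using assms subgroup_imp_group by blast
  show ?thesis
    using K.card_subgroup_dvd[of H] subgroup_incl[OF assms] by (simp add: order_def)
qed

lemma proper_subgroups_prime_product_antichain:
  assumes "Factorial_Ring.prime p" "Factorial_Ring.prime q" "order G = q * p"
    and HK: "H \<in> proper_subgroups G" "K \<in> proper_subgroups G" "H \<subseteq> K"
  shows "H = K"
proof -
  have fin: "finite (carrier G)"
    using assms by (metis mult_eq_0_iff not_prime_0 order_gt_0_iff_finite neq0_conv)
  have card: "Factorial_Ring.prime (card L)" if L: "L \<in> proper_subgroups G" for L
  proof -
    from L have sub: "subgroup L G" and "L \<noteq> {\<one>}" "L \<noteq> carrier G" "L \<subseteq> carrier G" "\<one> \<in> L"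
      by (auto simp: proper_subgroups_def subgroup.one_closed dest: subgroup.subset)
    then have "card L \<noteq> 1" "card L \<noteq> q * p"
      using fin card_subset_eq[of "carrier G" L] assms(3)
      by (auto simp: order_def card_1_singleton_iff)
    moreover have "card L dvd q * p" using card_subgroup_dvd[OF sub] assms by simp
    ultimately show ?thesis
      using assms(1,2) by (smt (verit, del_insts) division_decomp mult.right_neutral mult_1 prime_nat_iff)
  qed
  have sub: "subgroup H G" "subgroup K G" using HK by (auto simp: proper_subgroups_def)
  have "card H = card K"
    using card_subgroup_dvd_card[OF sub HK(3)] card[OF HK(1)] card[OF HK(2)]
    by (rule primes_dvd_imp_eq[rotated 2])
  then show ?thesis
    using card_subset_eq HK(3) finite_subset[OF subgroup.subset[OF sub(2)] fin] by blast
qed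

text \<open>
  A subgroup that is not contained in \<open>C\<close> contains some involution \<open>x\<close> outside \<open>C\<close>, and hence the
  subgroup \<open>{1, x}\<close>; by the antichain property it equals \<open>{1, x}\<close> if it is proper.
\<close>

theorem proper_subgroups_dihedral_type:
  assumes p: "Factorial_Ring.prime p" and ord: "order G = 2 * p"
    and C: "subgroup C G" "card C = p"
    and invol: "\<And>x. x \<in> carrier G - C \<Longrightarrow> x \<otimes> x = \<one>"
  shows "proper_subgroups G = insert C ((\<lambda>x. {\<one>, x}) ` (carrier G - C))"
    and "card (proper_subgroups G) = p + 1"
proof -
  have p1: "p > 1" using p prime_gt_1_nat by blast
  have fin: "finite (carrier G)" using ord p1 order_gt_0_iff_finite by auto
  have sC: "C \<subseteq> carrier G" and oC: "\<one> \<in> C"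
    using C subgroup.subset subgroup.one_closed by blast+
  have anti: "H = K" if "H \<in> proper_subgroups G" "K \<in> proper_subgroups G" "H \<subseteq> K" for H K
    using proper_subgroups_prime_product_antichain[OF p two_is_prime_nat ord that] .
  have "C \<noteq> {\<one>}" "C \<noteq> carrier G" using C(2) ord p1 by (auto simp: order_def)
  then have CP: "C \<in> proper_subgroups G" using C by (simp add: proper_subgroups_def)
  have refl: "{\<one>, x} \<in> proper_subgroups G" if x: "x \<in> carrier G - C" for x
  proof -
    have "inv x = x" using x invol inv_unique' by force
    then have "subgroup {\<one>, x} G"
      using x invol[OF x] by (intro subgroupI) auto
    moreover have "card {\<one>, x} < card (carrier G)"
      using ord p1 by (intro le_less_trans[OF card_insert_le_m1[of 2]]) (auto simp: order_def)
    ultimately show ?thesis using x oC by (auto simp: proper_subgroups_def)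
  qed
  show eq: "proper_subgroups G = insert C ((\<lambda>x. {\<one>, x}) ` (carrier G - C))"
  proof (intro equalityI subsetI)
    fix H assume H: "H \<in> proper_subgroups G"
    have HG: "H \<subseteq> carrier G" "\<one> \<in> H" using H by (auto elim: proper_subgroupE)
    show "H \<in> insert C ((\<lambda>x. {\<one>, x}) ` (carrier G - C))"
    proof (cases "H \<subseteq> C")
      case True then show ?thesis using anti[OF H CP] by blast
    next
      case False
      then obtain x where x: "x \<in> H" "x \<in> carrier G - C" using HG by blast
      then have "{\<one>, x} = H" using anti[OF refl H] HG by blast
      then show ?thesis using x by blast
    qed
  qed (use CP refl in auto)
  have "inj_on (\<lambda>x. {\<one>, x}) (carrier G - C)" using oC by (auto simp: inj_on_def doubleton_eq_iff)
  then have "card ((\<lambda>x. {\<one>, x}) ` (carrier G - C)) = p"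
    using fin sC C ord by (simp add: card_image card_Diff_subset finite_subset order_def)
  moreover have "C \<notin> (\<lambda>x. {\<one>, x}) ` (carrier G - C)" by auto
  ultimately show "card (proper_subgroups G) = p + 1"
    unfolding eq using fin by simp
qed

end

section \<open>The dihedral presentation\<close>

text \<open>
  In any group, generators subject to the dihedral relations yield the structure used above as soon
  as they are not degenerate, that is, \<open>a \<noteq> 1\<close> and \<open>b\<close> is not a power of \<open>a\<close>.
\<close>

lemma (in group) dihedral_generators:
  assumes p: "Factorial_Ring.prime p"
    and a: "a \<in> carrier G" "a [^] p = \<one>" "a \<noteq> \<one>"
    and b: "b \<in> carrier G" "b \<otimes> b = \<one>" "b \<otimes> a \<otimes> b = inv a" "b \<notin> generate G {a}"
    and gen: "carrier G = generate G {a, b}"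
  shows "card (generate G {a}) = p" "order G = 2 * p"
    and "\<And>x. x \<in> carrier G - generate G {a} \<Longrightarrow> x \<otimes> x = \<one>"
proof -
  define C where "C = generate G {a}"
  have C: "subgroup C G" unfolding C_def using a generate_is_subgroup by simp
  interpret C: subgroup C G by (rule C)
  have "ord a dvd p" "ord a \<noteq> 1" using a pow_eq_id ord_eq_1 by auto
  then have "ord a = p" using p by (auto simp: prime_nat_iff)
  then show cardC: "card (generate G {a}) = p" using generate_pow_card a by simp
  then have finC: "finite C"
    using p card.infinite not_prime_0 unfolding C_def by metis
  have bib: "inv b = b" using b inv_unique' by force
  \<comment> \<open>Conjugation by \<open>b\<close> is an endomorphism that inverts \<open>a\<close>, hence all powers of \<open>a\<close>.\<close>
  interpret conj: group_hom G G "\<lambda>x. b \<otimes> x \<otimes> b"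
  proof (unfold_locales, rule homI)
    fix x y assume xy: "x \<in> carrier G" "y \<in> carrier G"
    have "b \<otimes> x \<otimes> b \<otimes> (b \<otimes> y \<otimes> b) = b \<otimes> x \<otimes> (b \<otimes> b) \<otimes> y \<otimes> b"
      using xy b(1) by (simp only: m_assoc m_closed)
    then show "b \<otimes> (x \<otimes> y) \<otimes> b = b \<otimes> x \<otimes> b \<otimes> (b \<otimes> y \<otimes> b)"
      using xy b by (simp add: m_assoc)
  qed (use b in auto)
  have conj: "b \<otimes> c \<otimes> b = inv c" if c: "c \<in> C" for c
  proof -
    from c obtain k :: int where "c = a [^] k" using generate_pow a by (auto simp: C_def)
    then show ?thesis using conj.hom_int_pow[of a k] a b int_pow_inv by simp
  qed
  have bc: "b \<otimes> c = inv c \<otimes> b" if c: "c \<in> C" for c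
  proof -
    have "b \<otimes> c \<otimes> b \<otimes> b = b \<otimes> c" using b c by (simp add: m_assoc)
    then show ?thesis using conj[OF c] by simp
  qed
  \<comment> \<open>The two cosets of \<open>C\<close> are closed under products and contain the generators.\<close>
  have mult: "x \<otimes> y \<in> C \<union> (C #> b)" if "x \<in> C \<union> (C #> b)" "y \<in> C \<union> (C #> b)" for x y
  proof -
    have 1: "c \<otimes> (d \<otimes> b) = (c \<otimes> d) \<otimes> b" "c \<otimes> b \<otimes> d = (c \<otimes> inv d) \<otimes> b"
      "c \<otimes> b \<otimes> (d \<otimes> b) = c \<otimes> inv d" if cd: "c \<in> C" "d \<in> C" for c d
    proof -
      show "c \<otimes> (d \<otimes> b) = (c \<otimes> d) \<otimes> b" using cd b by (simp add: m_assoc)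
      have "c \<otimes> b \<otimes> d = c \<otimes> (b \<otimes> d)" using cd b by (simp add: m_assoc)
      then show 2: "c \<otimes> b \<otimes> d = (c \<otimes> inv d) \<otimes> b" using cd b bc by (simp add: m_assoc)
      have "c \<otimes> b \<otimes> (d \<otimes> b) = c \<otimes> b \<otimes> d \<otimes> b" using cd b by (simp add: m_assoc)
      also have "\<dots> = c \<otimes> inv d" unfolding 2 using cd b by (simp add: m_assoc)
      finally show "c \<otimes> b \<otimes> (d \<otimes> b) = c \<otimes> inv d" .
    qed
    show ?thesis using that unfolding r_coset_def by (auto simp: 1)
  qed
  have aC: "a \<in> C" and oC: "\<one> \<in> C" by (auto simp: C_def intro: generate.incl generate.one)
  have bCb: "b \<in> C #> b" using oC b by (auto simp: r_coset_def intro!: bexI[of _ \<one>])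
  have "x \<in> C \<union> (C #> b)" if "x \<in> generate G {a, b}" for x
    using that by induction (use aC oC bCb bib mult in auto)
  then have carr: "carrier G = C \<union> (C #> b)"
    using gen C.subset r_coset_subset_G[OF C.subset b(1)] by blast
  have "C \<inter> (C #> b) = {}"
  proof (rule ccontr)
    assume "C \<inter> (C #> b) \<noteq> {}"
    then obtain c d where cd: "c \<in> C" "d \<in> C" "c = d \<otimes> b" by (auto simp: r_coset_def)
    then have "b = inv d \<otimes> c" using b by (simp add: m_assoc[symmetric])
    also have "\<dots> \<in> C" using cd(1,2) by simp
    finally show False using b(4) by (simp add: C_def)
  qed
  moreover have "card (C #> b) = p"
    using card_rcosets_equal[OF rcosetsI[OF C.subset b(1)] C.subset] cardC by (simp add: C_def)
  ultimately show "order G = 2 * p"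
    unfolding order_def carr using cardC finC finite_subset
    by (subst card_Un_disjoint) (auto simp: C_def r_coset_def)
  show "x \<otimes> x = \<one>" if "x \<in> carrier G - generate G {a}" for x
  proof -
    from that obtain c where c: "c \<in> C" "x = c \<otimes> b" using carr by (auto simp: C_def r_coset_def)
    have "x \<otimes> x = c \<otimes> (b \<otimes> c \<otimes> b)" using c b by (simp add: m_assoc)
    then show ?thesis using conj c by simp
  qed
qed

text \<open>
  The action of words on the integers in which \<open>\<alpha>\<close> translates by \<open>1\<close> and \<open>\<beta>\<close> is \<open>x \<mapsto> - x\<close>. The
  relations of the dihedral group hold only modulo \<open>n\<close>; working with integers and divisibility
  avoids a type of residues.
\<close>

fun dihedral_act :: "dihedral_gen word \<Rightarrow> int \<Rightarrow> int" where
  "dihedral_act [] x = x"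
| "dihedral_act ((Alpha, s) # w) x = dihedral_act w x + (if s then 1 else -1)"
| "dihedral_act ((Beta, s) # w) x = - dihedral_act w x"

lemma dihedral_act_append: "dihedral_act (u @ v) x = dihedral_act u (dihedral_act v x)"
  by (induction u x rule: dihedral_act.induct) auto

text \<open>Affinity makes the action of a word compatible with congruence modulo any integer.\<close>

lemma dihedral_act_affine: "\<exists>e. \<forall>x y. dihedral_act u x - dihedral_act u y = e * (x - y)"
proof (induction u)
  case Nil show ?case by (auto intro: exI[of _ 1])
next
  case (Cons l u)
  then obtain e where "\<forall>x y. dihedral_act u x - dihedral_act u y = e * (x - y)" by blast
  then show ?case
    by (cases l; cases "fst l") (auto intro: exI[of _ e] exI[of _ "- e"] simp: algebra_simps)
qed

lemma dihedral_act_replicate_Alpha: "dihedral_act (replicate k (Alpha, True)) x = x + int k"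
  by (induction k) auto

lemma pres_eq_dihedral_act:
  "pres_eq (dihedral_relations n) u v \<Longrightarrow> int n dvd dihedral_act u x - dihedral_act v x"
proof (induction arbitrary: x rule: pres_eq.induct)
  case (rel u v)
  then show ?case by (auto simp: dihedral_relations_def dihedral_act_replicate_Alpha)
next
  case (cancel y s) then show ?case by (cases y) auto
next
  case (sym u v) then show ?case using dvd_diff_commute by blast
next
  case (trans u v w)
  then show ?case using dvd_add[OF trans.IH(1)[of x] trans.IH(2)[of x]] by simp
next
  case (cong u u' v v')
  obtain e where e: "\<forall>x y. dihedral_act u x - dihedral_act u y = e * (x - y)"
    using dihedral_act_affine by blast
  have "dihedral_act (u @ v) x - dihedral_act (u' @ v') x =
      e * (dihedral_act v x - dihedral_act v' x) +
      (dihedral_act u (dihedral_act v' x) - dihedral_act u' (dihedral_act v' x))"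
    using e[rule_format, symmetric] by (simp add: dihedral_act_append)
  then show ?case using cong.IH by simp
qed auto

lemma presented_group_generated:
  "carrier (presented_group R) = generate (presented_group R) (range (\<lambda>x. pres_class R [(x, True)]))"
  (is "_ = generate ?P ?S")
proof -
  interpret group ?P by (rule group_presented_group)
  have in_carrier: "pres_class R w \<in> carrier ?P" for w by (simp add: presented_group_def)
  have one: "\<one>\<^bsub>?P\<^esub> = pres_class R []" by (simp add: presented_group_def)
  have letter: "pres_class R [(x, s)] \<in> generate ?P ?S" for x s
  proof (cases s)
    case True then show ?thesis by (auto intro: generate.incl)
  next
    case False
    have "pres_class R [(x, False)] \<otimes>\<^bsub>?P\<^esub> pres_class R [(x, True)] = \<one>\<^bsub>?P\<^esub>"
      using pres_eq.cancel[of R x False] by (simp add: one mult_pres_class pres_class_eq_iff)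
    then have "inv\<^bsub>?P\<^esub> (pres_class R [(x, True)]) = pres_class R [(x, False)]"
      using in_carrier inv_equality by blast
    then show ?thesis using False generate.inv[of "pres_class R [(x, True)]" ?S ?P] by auto
  qed
  have "pres_class R w \<in> generate ?P ?S" for w
  proof (induction w)
    case Nil show ?case using generate.one[of ?P ?S] by (simp add: one)
  next
    case (Cons l w)
    have "pres_class R (l # w) = pres_class R [l] \<otimes>\<^bsub>?P\<^esub> pres_class R w"
      by (simp add: mult_pres_class)
    then show ?case using generate.eng letter Cons by (metis surj_pair)
  qed
  then show ?thesis
    using generate_incl[of ?S] in_carrier by (auto simp: presented_group_def)
qed

lemma dihedral_group_structure:
  assumes p: "Factorial_Ring.prime p" "p \<ge> 3"
  obtains C where "subgroup C (dihedral_group p)" "card C = p" "order (dihedral_group p) = 2 * p"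
    "\<And>x. x \<in> carrier (dihedral_group p) - C \<Longrightarrow>
      x \<otimes>\<^bsub>dihedral_group p\<^esub> x = \<one>\<^bsub>dihedral_group p\<^esub>"
proof -
  let ?D = "dihedral_group p"
  let ?R = "dihedral_relations p"
  interpret group ?D unfolding dihedral_group_def by (rule group_presented_group)
  define cl where "cl = pres_class ?R"
  define a b where "a = cl [(Alpha, True)]" and "b = cl [(Beta, True)]"
  have cl: "cl w \<in> carrier ?D" "cl u \<otimes>\<^bsub>?D\<^esub> cl v = cl (u @ v)" "\<one>\<^bsub>?D\<^esub> = cl []"
    "cl u = cl v \<longleftrightarrow> pres_eq ?R u v" for u v w
    by (simp_all add: cl_def dihedral_group_def mult_pres_class pres_class_eq_iff)
      (simp_all add: presented_group_def)
  have pow: "a [^]\<^bsub>?D\<^esub> k = cl (replicate k (Alpha, True))" for k :: nat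
    by (induction k) (simp_all add: cl a_def replicate_append_same)
  have carr: "a \<in> carrier ?D" "b \<in> carrier ?D" by (simp_all add: a_def b_def cl)
  have rels: "a [^]\<^bsub>?D\<^esub> p = \<one>\<^bsub>?D\<^esub>" "b \<otimes>\<^bsub>?D\<^esub> b = \<one>\<^bsub>?D\<^esub>"
    "b \<otimes>\<^bsub>?D\<^esub> a \<otimes>\<^bsub>?D\<^esub> b = cl [(Alpha, False)]"
    unfolding pow unfolding a_def b_def cl
    by (auto intro!: pres_eq.rel simp: dihedral_relations_def)
  have "cl [(Alpha, False)] \<otimes>\<^bsub>?D\<^esub> a = \<one>\<^bsub>?D\<^esub>"
    using pres_eq.cancel[of ?R Alpha False] by (simp add: a_def cl)
  then have inva: "inv\<^bsub>?D\<^esub> a = cl [(Alpha, False)]" using inv_equality carr(1) cl(1) by metis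
  \<comment> \<open>The generators are not degenerate: the translation by \<open>1\<close> is not the identity modulo \<open>p\<close>, and
    \<open>x \<mapsto> - x\<close> is not a translation modulo \<open>p\<close>, since \<open>p\<close> does not divide \<open>2\<close>.\<close>
  have a1: "a \<noteq> \<one>\<^bsub>?D\<^esub>"
  proof
    assume "a = \<one>\<^bsub>?D\<^esub>"
    then have "pres_eq ?R [(Alpha, True)] []" by (simp add: a_def cl)
    from pres_eq_dihedral_act[OF this, of 0] show False using p by simp
  qed
  have bC: "b \<notin> generate ?D {a}"
  proof
    assume "b \<in> generate ?D {a}"
    moreover have "ord a \<noteq> 0" using pow_eq_id[OF carr(1), of p] rels(1) p by (intro notI) simp
    ultimately obtain k :: nat where "b = a [^]\<^bsub>?D\<^esub> k"
      using generate_pow_nat[OF carr(1)] by auto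
    then have "pres_eq ?R [(Beta, True)] (replicate k (Alpha, True))"
      by (simp add: pow b_def cl)
    from pres_eq_dihedral_act[OF this]
    have d: "int p dvd - x - (x + int k)" for x by (simp add: dihedral_act_replicate_Alpha)
    \<comment> \<open>Subtract the instances at \<open>0\<close> and \<open>1\<close>; the unknown exponent \<open>k\<close> cancels.\<close>
    have "int p dvd 2" using dvd_diff[OF d[of 0] d[of 1]] by simp
    then show False using p zdvd_imp_le[of "int p" 2] by simp
  qed
  have univ: "(UNIV :: dihedral_gen set) = {Alpha, Beta}"
    by (auto intro: dihedral_gen.exhaust)
  have "range (\<lambda>x. pres_class ?R [(x, True)]) = {a, b}"
    unfolding univ by (simp add: a_def b_def cl_def)
  then have gen: "carrier ?D = generate ?D {a, b}"
    unfolding dihedral_group_def by (subst presented_group_generated) simp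
  note D = dihedral_generators[OF p(1) carr(1) rels(1) a1 carr(2) rels(2) rels(3)[folded inva] bC gen]
  show thesis
    by (rule that[of "generate ?D {a}"]) (use D generate_is_subgroup carr in auto)
qed

theorem theorem6p3:
  fixes G :: "('a, 'b) monoid_scheme" and p :: nat
  assumes "Factorial_Ring.prime p" and "p \<ge> 3"
    and "group G" and "G \<cong> dihedral_group p"
  shows "num_fuzzy_subgroups G = 4 * p + 7"
proof -
  let ?D = "dihedral_group p"
  interpret group G by fact
  interpret D: group ?D unfolding dihedral_group_def by (rule group_presented_group)
  obtain C where C: "subgroup C ?D" "card C = p" "order ?D = 2 * p"
    "\<And>x. x \<in> carrier ?D - C \<Longrightarrow> x \<otimes>\<^bsub>?D\<^esub> x = \<one>\<^bsub>?D\<^esub>"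
    using dihedral_group_structure[OF assms(1,2)] by blast
  obtain h where h: "h \<in> iso ?D G"
    using iso_sym[OF assms(4)] by (auto simp: is_iso_def)
  interpret h: group_hom ?D G h
    using h by unfold_locales (simp add: iso_def)
  have bij: "inj_on h (carrier ?D)" "h ` carrier ?D = carrier G"
    using h by (auto simp: iso_def bij_betw_def)
  have ord: "order G = 2 * p" using C(3) bij by (metis card_image order_def)
  have img: "subgroup (h ` C) G" "card (h ` C) = p"
    using h.subgroup_img_is_subgroup[OF C(1)] C(1,2)
      card_image[OF inj_on_subset[OF bij(1) subgroup.subset[OF C(1)]]] by auto
  have invol: "x \<otimes>\<^bsub>G\<^esub> x = \<one>\<^bsub>G\<^esub>" if "x \<in> carrier G - h ` C" for x
  proof -
    from that bij(2) obtain y where y: "y \<in> carrier ?D - C" "x = h y" by blast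
    then have "h (y \<otimes>\<^bsub>?D\<^esub> y) = x \<otimes>\<^bsub>G\<^esub> x" by simp
    then show ?thesis using C(4)[OF y(1)] by simp
  qed
  have card: "card (proper_subgroups G) = p + 1"
    using proper_subgroups_dihedral_type(2)[OF assms(1) ord img invol] by blast
  have "num_fuzzy_subgroups G = 4 * card (proper_subgroups G) + 3"
  proof (rule num_fuzzy_subgroups_antichain)
    show "carrier G \<noteq> {\<one>\<^bsub>G\<^esub>}" using ord assms(2) by (auto simp: order_def)
    show "finite (proper_subgroups G)" using card card.infinite by fastforce
  qed (use proper_subgroups_prime_product_antichain[OF assms(1) two_is_prime_nat ord] in blast)
  then show ?thesis using card by simp
qed

end
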